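(* Let $a,b\in\mathbb{C}$, let $U\subset\mathbb{C}$ be open, and let $[0,1]\ni\tau\mapsto\gamma(\tau)$ be a contour which satisfies, for every $z\in U$, $$e^{-\frac{1}{t}}t^{b-a+1}(t-z)^{-b-1}\Big|_{t=\gamma(0)}^{t=\gamma(1)}=0.$$ Then, for $z\in U$, $$\Big(z^2\partial_z^2+\big(-1+(1+a+b)z\big)\partial_z+ab\Big)\int_\gamma e^{-\frac{1}{t}}t^{b-a-1}(t-z)^{-b}\,dt=0.$$
   Context: The operator $\mathcal{F}(a,b;-;z,\partial_z):=z^2\partial_z^2+\big(-1+(1+a+b)z\big)\partial_z+ab$ is the ${}_2F_0$ operator. Notation: $f(t)\big|_{t=\gamma(0)}^{t=\gamma(1)}$ denotes $f(\gamma(1))-f(\gamma(0))$, where multivalued functions are continued analytically along $\gamma$ (so for a closed contour the two values may differ). Conventions on contours: $\gamma$ does not depend on $z\in U$; it is piecewise smooth on $]0,1[$ and there avoids $0$ and all $z\in U$. Branches of the powers are fixed by a continuous choice of the logarithms of $t$ and $t-z$ along $\gamma$ (holomorphic in $z\in U$), and the same choice is used in the integrand and in the boundary condition. Endpoints may be singular points or infinity, in which case values there mean limits along $\gamma$. The integral is assumed to converge and to be twice differentiable in $z\in U$ under the integral sign. *)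

theory Defs
  imports "HOL-Analysis.Analysis"
begin

definition hyp2F0_op :: "complex \<Rightarrow> complex \<Rightarrow> (complex \<Rightarrow> complex) \<Rightarrow> complex \<Rightarrow> complex" where
  "hyp2F0_op a b f z =
     z\<^sup>2 * (deriv ^^ 2) f z + (- 1 + (1 + a + b) * z) * deriv f z + a * b * f z"

text \<open>
  An endpoint of a contour is a point of the Riemann sphere. Since infinity is not a value of
  type \<^typ>\<open>complex\<close>, a contour is given by its restriction to the open interval, and
  its endpoints by its limits; the values of the function at 0 and 1 are never used.
\<close>

definition has_endpoint :: "(real \<Rightarrow> complex) \<Rightarrow> real filter \<Rightarrow> bool" where
  "has_endpoint \<gamma> F \<longleftrightarrow> (\<exists>p. (\<gamma> \<longlongrightarrow> p) F) \<or> filterlim \<gamma> at_infinity F"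

definition contour :: "(real \<Rightarrow> complex) \<Rightarrow> bool" where
  "contour \<gamma> \<longleftrightarrow> \<gamma> piecewise_C1_differentiable_on {0<..<1} \<and>
     has_endpoint \<gamma> (at_right 0) \<and> has_endpoint \<gamma> (at_left 1)"

text \<open>
  Multivalued functions continued along a contour are functions of the parameter, not of the
  point \<open>t\<close>: the contour may return to a point on another branch. The functions
  \<open>L\<close> and \<open>M z\<close> below are the chosen logarithms of \<open>t\<close> and
  \<open>t - z\<close>; the power \<open>t\<^sup>c\<close> is then \<open>exp (c * L \<tau>)\<close>, and similarly
  for \<open>t - z\<close>.
\<close>

definition log_branch :: "(real \<Rightarrow> complex) \<Rightarrow> (real \<Rightarrow> complex) \<Rightarrow> bool" where
  "log_branch \<gamma> L \<longleftrightarrow>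
     continuous_on {0<..<1} L \<and> (\<forall>\<tau>\<in>{0<..<1}. exp (L \<tau>) = \<gamma> \<tau>)"

definition log_branch_family ::
  "complex set \<Rightarrow> (real \<Rightarrow> complex) \<Rightarrow> (complex \<Rightarrow> real \<Rightarrow> complex) \<Rightarrow> bool" where
  "log_branch_family U \<gamma> M \<longleftrightarrow>
     (\<forall>z\<in>U. log_branch (\<lambda>\<tau>. \<gamma> \<tau> - z) (M z)) \<and>
     (\<forall>\<tau>\<in>{0<..<1}. (\<lambda>z. M z \<tau>) holomorphic_on U)"

text \<open>The function \<open>e\<^sup>-\<^sup>1\<^sup>/\<^sup>t t\<^sup>p (t - z)\<^sup>q\<close> along \<open>\<gamma>\<close>.\<close>

definition branch_integrand ::
  "(real \<Rightarrow> complex) \<Rightarrow> (real \<Rightarrow> complex) \<Rightarrow> (complex \<Rightarrow> real \<Rightarrow> complex) \<Rightarrow>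
     complex \<Rightarrow> complex \<Rightarrow> complex \<Rightarrow> real \<Rightarrow> complex" where
  "branch_integrand \<gamma> L M p q z \<tau> = exp (- 1 / \<gamma> \<tau>) * exp (p * L \<tau>) * exp (q * M z \<tau>)"

definition has_boundary_value :: "(real \<Rightarrow> complex) \<Rightarrow> complex \<Rightarrow> bool" where
  "has_boundary_value h d \<longleftrightarrow>
     (\<exists>h0 h1. (h \<longlongrightarrow> h0) (at_right 0) \<and> (h \<longlongrightarrow> h1) (at_left 1) \<and> d = h1 - h0)"

text \<open>
  The integrals are gauge integrals over the open interval, as in the library's
  \<^const>\<open>has_integral\<close>; by Hake's theorem they include conditionally convergent
  improper integrals.
\<close>

definition integrable_along :: "(real \<Rightarrow> complex) \<Rightarrow> (real \<Rightarrow> complex) \<Rightarrow> bool" where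
  "integrable_along \<gamma> h \<longleftrightarrow>
     (\<lambda>\<tau>. h \<tau> * vector_derivative \<gamma> (at \<tau>)) integrable_on {0<..<1}"

definition integral_along :: "(real \<Rightarrow> complex) \<Rightarrow> (real \<Rightarrow> complex) \<Rightarrow> complex" where
  "integral_along \<gamma> h = integral {0<..<1} (\<lambda>\<tau>. h \<tau> * vector_derivative \<gamma> (at \<tau>))"

text \<open>Here \<open>(deriv ^^ k) (\<lambda>w. f w \<tau>) z\<close> is the \<open>k\<close>-th partial derivative in \<open>z\<close>.\<close>

definition twice_differentiable_under_integral ::
  "complex set \<Rightarrow> (real \<Rightarrow> complex) \<Rightarrow> (complex \<Rightarrow> real \<Rightarrow> complex) \<Rightarrow> bool" where
  "twice_differentiable_under_integral U \<gamma> f \<longleftrightarrow>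
     (\<forall>z\<in>U.
        (\<forall>k\<le>2. integrable_along \<gamma> (\<lambda>\<tau>. (deriv ^^ k) (\<lambda>w. f w \<tau>) z)) \<and>
        (\<forall>k<2. ((\<lambda>w. integral_along \<gamma> (\<lambda>\<tau>. (deriv ^^ k) (\<lambda>w. f w \<tau>) w))
           has_field_derivative
             integral_along \<gamma> (\<lambda>\<tau>. (deriv ^^ Suc k) (\<lambda>w. f w \<tau>) z)) (at z)))"

end

theory Submission imports Defs begin

text \<open>
  Write \<open>f\<close> for the integrand
  \<open>e\<^sup>-\<^sup>1\<^sup>/\<^sup>t t\<^sup>p (t - z)\<^sup>q\<close> with \<open>p = b - a - 1\<close>, \<open>q = - b\<close>, and \<open>G\<close> for the function
  with exponents \<open>p + 2\<close>, \<open>q - 1\<close> that appears in the boundary condition. Then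
  the operator turns \<open>f\<close> into an exact \<open>t\<close>-derivative,
  \<open>F(a,b;-;z,\<partial>\<^sub>z) f = - b \<partial>\<^sub>t G\<close>.
  Indeed both sides are \<open>- b (t - z)\<^sup>-\<^sup>2 f\<close> times a polynomial, and the two polynomials agree:
  with \<open>s = t - z\<close> each of them is
  \<open>s - a s\<^sup>2 - (1 + a + b) z s - (b + 1) z\<^sup>2\<close>. Applying the operator under the integral sign
  (\<open>hyp2F0_op_integral_along\<close>) therefore leaves \<open>- b\<close> times the
  difference of the endpoint limits of \<open>G\<close>, which vanishes.

  The powers are exponentials of multiples of chosen continuous logarithms, so the calculus of
  \<open>f\<close> and \<open>G\<close> rests on two facts: such a logarithm has the derivative dictated by
  the chain rule, along the contour and in \<open>z\<close>, and raising an exponent by one multiplies by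
  the base whatever the branch (\<open>branch_integrand_raise\<close>). The identity above, in
  \<open>hyp2F0_integrand_exact\<close>, is then polynomial algebra. The last step is the fundamental
  theorem of calculus for a function that is known only on the open parameter interval, where
  it is differentiable off a finite set, and has limits at the ends.
\<close>

section \<open>Derivatives of logarithms along a contour\<close>

text \<open>
  Near \<open>\<tau>\<close> continuity keeps \<open>L s - L \<tau>\<close> inside the strip where the
  principal logarithm inverts the exponential. So \<open>L\<close> is locally a constant plus the principal
  logarithm of \<open>\<gamma> s / \<gamma> \<tau>\<close>, a quotient close to 1 and hence away from the cut.
\<close>

lemma log_branch_has_vector_derivative:
  assumes L: "log_branch \<gamma> L" and \<tau>: "\<tau> \<in> {0<..<1}"
    and \<gamma>: "(\<gamma> has_vector_derivative d) (at \<tau>)"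
  shows "(L has_vector_derivative d / \<gamma> \<tau>) (at \<tau>)"
proof -
  have exp_L: "exp (L s) = \<gamma> s" if "s \<in> {0<..<1}" for s
    using L that by (auto simp: log_branch_def)
  have nz: "\<gamma> \<tau> \<noteq> 0"
    using exp_L[OF \<tau>] by (metis exp_not_eq_zero)
  have "isCont L \<tau>"
    using L \<tau> by (auto simp: log_branch_def continuous_on_eq_continuous_at)
  then have "((\<lambda>s. L s - L \<tau>) \<longlongrightarrow> 0) (at \<tau>)"
    using LIM_zero isCont_def by blast
  then have "\<forall>\<^sub>F s in at \<tau>. norm (L s - L \<tau>) < pi"
    by (metis eventually_at_topological order_tendstoD(2) pi_gt_zero tendsto_norm_zero)
  moreover have "\<forall>\<^sub>F s in at \<tau>. s \<in> {0<..<1}"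
    using \<tau> by (intro eventually_at_in_open') auto
  ultimately have ev: "\<forall>\<^sub>F s in at \<tau>. L \<tau> + Ln (\<gamma> s / \<gamma> \<tau>) = L s"
  proof eventually_elim
    case (elim s)
    have "\<bar>Im (L s - L \<tau>)\<bar> < pi"
      using elim(1) abs_Im_le_cmod le_less_trans by blast
    then have "Ln (exp (L s - L \<tau>)) = L s - L \<tau>"
      by (intro Ln_exp) auto
    then show ?case
      using exp_L[OF \<tau>] exp_L[OF elim(2)] by (simp add: exp_diff)
  qed
  have "((\<lambda>s. \<gamma> s / \<gamma> \<tau>) has_vector_derivative d / \<gamma> \<tau>) (at \<tau>)"
    using \<gamma> by (rule has_vector_derivative_divide)
  moreover have "(Ln has_field_derivative 1) (at (\<gamma> \<tau> / \<gamma> \<tau>))"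
    using nz by (auto intro!: derivative_eq_intros simp: complex_nonpos_Reals_iff)
  ultimately have "(Ln \<circ> (\<lambda>s. \<gamma> s / \<gamma> \<tau>) has_vector_derivative d / \<gamma> \<tau> * 1) (at \<tau>)"
    by (rule field_vector_diff_chain_at)
  then have "((\<lambda>s. L \<tau> + Ln (\<gamma> s / \<gamma> \<tau>)) has_vector_derivative d / \<gamma> \<tau>) (at \<tau>)"
    by (auto intro!: derivative_eq_intros simp: o_def)
  moreover have "L \<tau> + Ln (\<gamma> \<tau> / \<gamma> \<tau>) = L \<tau>"
    using nz by simp
  ultimately show ?thesis
    using ev has_vector_derivative_cong_ev
        [where x = \<tau> and S = UNIV and f = "\<lambda>s. L \<tau> + Ln (\<gamma> s / \<gamma> \<tau>)" and g = L]
    by (simp add: eventually_nhds_conv_at)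
qed

text \<open>
  Here differentiability is part of the hypothesis, so differentiating
  \<open>exp (M w \<tau>) = \<gamma> \<tau> - w\<close> determines the derivative.
\<close>

lemma log_branch_family_has_field_derivative:
  assumes "open U" and M: "log_branch_family U \<gamma> M" and \<tau>: "\<tau> \<in> {0<..<1}" and z: "z \<in> U"
  shows "((\<lambda>w. M w \<tau>) has_field_derivative - 1 / (\<gamma> \<tau> - z)) (at z)"
proof -
  have exp_M: "exp (M w \<tau>) = \<gamma> \<tau> - w" if "w \<in> U" for w
    using M \<tau> that by (auto simp: log_branch_family_def log_branch_def)
  obtain D where D: "((\<lambda>w. M w \<tau>) has_field_derivative D) (at z)"
    using M \<tau> z \<open>open U\<close>
    by (metis log_branch_family_def holomorphic_on_imp_differentiable_at field_differentiable_def)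
  have "((\<lambda>w. exp (M w \<tau>)) has_field_derivative exp (M z \<tau>) * D) (at z)"
    using D by (auto intro!: derivative_eq_intros)
  moreover have "((\<lambda>w. exp (M w \<tau>)) has_field_derivative - 1) (at z)"
    by (rule has_field_derivative_transform_within_open[of "\<lambda>w. \<gamma> \<tau> - w" _ _ U])
      (use \<open>open U\<close> z exp_M in \<open>auto intro!: derivative_eq_intros\<close>)
  ultimately have "exp (M z \<tau>) * D = - 1"
    by (rule DERIV_unique)
  moreover have "\<gamma> \<tau> - z \<noteq> 0"
    using exp_M[OF z] by (metis exp_not_eq_zero)
  ultimately have "D = - 1 / (\<gamma> \<tau> - z)"
    using exp_M[OF z] by (simp add: field_simps)
  with D show ?thesis by simp
qed

section \<open>Calculus of the branch integrand\<close>

lemma branch_integrand_raise: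
  assumes "log_branch \<gamma> L" "log_branch_family U \<gamma> M" "\<tau> \<in> {0<..<1}" "z \<in> U"
  shows "branch_integrand \<gamma> L M (p + 1) q z \<tau> = \<gamma> \<tau> * branch_integrand \<gamma> L M p q z \<tau>"
    and "branch_integrand \<gamma> L M p (q + 1) z \<tau> = (\<gamma> \<tau> - z) * branch_integrand \<gamma> L M p q z \<tau>"
proof -
  have "exp (L \<tau>) = \<gamma> \<tau>" "exp (M z \<tau>) = \<gamma> \<tau> - z"
    using assms by (auto simp: log_branch_family_def log_branch_def)
  then show "branch_integrand \<gamma> L M (p + 1) q z \<tau> = \<gamma> \<tau> * branch_integrand \<gamma> L M p q z \<tau>"
    and "branch_integrand \<gamma> L M p (q + 1) z \<tau> = (\<gamma> \<tau> - z) * branch_integrand \<gamma> L M p q z \<tau>"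
    by (simp_all add: branch_integrand_def ring_distribs exp_add)
qed

lemma has_field_derivative_branch_integrand:
  assumes "open U" "log_branch \<gamma> L" "log_branch_family U \<gamma> M" "\<tau> \<in> {0<..<1}" "z \<in> U"
  shows "((\<lambda>w. branch_integrand \<gamma> L M p q w \<tau>) has_field_derivative
           - q * branch_integrand \<gamma> L M p (q - 1) z \<tau>) (at z)"
proof -
  have "exp (M z \<tau>) = \<gamma> \<tau> - z"
    using assms by (auto simp: log_branch_family_def log_branch_def)
  then have nz: "\<gamma> \<tau> - z \<noteq> 0"
    by (metis exp_not_eq_zero)
  have "((\<lambda>w. branch_integrand \<gamma> L M p q w \<tau>) has_field_derivative
           - q * branch_integrand \<gamma> L M p q z \<tau> / (\<gamma> \<tau> - z)) (at z)"
    unfolding branch_integrand_def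
    by (rule derivative_eq_intros refl log_branch_family_has_field_derivative[OF assms(1,3-5)])+
      simp
  then show ?thesis
    using nz branch_integrand_raise(2)[OF assms(2-5), of p "q - 1"] by simp
qed

lemma higher_deriv_branch_integrand:
  assumes "open U" "log_branch \<gamma> L" "log_branch_family U \<gamma> M" "\<tau> \<in> {0<..<1}" "z \<in> U"
  shows "(deriv ^^ k) (\<lambda>w. branch_integrand \<gamma> L M p q w \<tau>) z =
           pochhammer (- q) k * branch_integrand \<gamma> L M p (q - of_nat k) z \<tau>"
  using \<open>z \<in> U\<close>
proof (induction k arbitrary: z)
  case 0
  then show ?case by simp
next
  case (Suc k)
  have "((\<lambda>w. pochhammer (- q) k * branch_integrand \<gamma> L M p (q - of_nat k) w \<tau>)
          has_field_derivative
          pochhammer (- q) (Suc k) * branch_integrand \<gamma> L M p (q - of_nat (Suc k)) z \<tau>) (at z)"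
    by (rule derivative_eq_intros refl
          has_field_derivative_branch_integrand[OF assms(1-4) Suc.prems])+
      (simp add: pochhammer_Suc algebra_simps)
  then have "((deriv ^^ k) (\<lambda>w. branch_integrand \<gamma> L M p q w \<tau>) has_field_derivative
          pochhammer (- q) (Suc k) * branch_integrand \<gamma> L M p (q - of_nat (Suc k)) z \<tau>) (at z)"
    by (rule has_field_derivative_transform_within_open[OF _ \<open>open U\<close> Suc.prems])
      (simp add: Suc.IH)
  then show ?case by (simp add: DERIV_imp_deriv)
qed

text \<open>
  The logarithmic derivative in \<open>t\<close> is \<open>1/t\<^sup>2 + p/t + q/(t - z)\<close>; each
  denominator is absorbed by lowering an exponent, so that no division remains.
\<close>

lemma has_vector_derivative_branch_integrand:
  assumes L: "log_branch \<gamma> L" and M: "log_branch_family U \<gamma> M"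
    and \<tau>: "\<tau> \<in> {0<..<1}" and z: "z \<in> U"
    and \<gamma>: "(\<gamma> has_vector_derivative d) (at \<tau>)"
  shows "(branch_integrand \<gamma> L M p q z has_vector_derivative
           (branch_integrand \<gamma> L M (p - 2) q z \<tau> + p * branch_integrand \<gamma> L M (p - 1) q z \<tau>
             + q * branch_integrand \<gamma> L M p (q - 1) z \<tau>) * d) (at \<tau>)"
proof -
  have Mz: "log_branch (\<lambda>s. \<gamma> s - z) (M z)"
    using M z by (simp add: log_branch_family_def)
  have nz: "\<gamma> \<tau> \<noteq> 0" "\<gamma> \<tau> - z \<noteq> 0"
    using L Mz \<tau> unfolding log_branch_def by (metis exp_not_eq_zero)+
  let ?E = "\<lambda>s. - 1 / \<gamma> s + p * L s + q * M z s"
  have dL: "(L has_vector_derivative d / \<gamma> \<tau>) (at \<tau>)"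
    by (rule log_branch_has_vector_derivative[OF L \<tau> \<gamma>])
  have dM: "(M z has_vector_derivative d / (\<gamma> \<tau> - z)) (at \<tau>)"
    by (rule log_branch_has_vector_derivative[OF Mz \<tau>]) (auto intro!: derivative_eq_intros \<gamma>)
  have "((\<lambda>x. - 1 / x) has_field_derivative 1 / (\<gamma> \<tau>)\<^sup>2) (at (\<gamma> \<tau>))"
    using nz by (auto intro!: derivative_eq_intros simp: power2_eq_square)
  from field_vector_diff_chain_at[OF \<gamma> this]
  have dI: "((\<lambda>s. - 1 / \<gamma> s) has_vector_derivative d * (1 / (\<gamma> \<tau>)\<^sup>2)) (at \<tau>)"
    by (simp add: o_def)
  have "(?E has_vector_derivative
           d * (1 / (\<gamma> \<tau>)\<^sup>2) + p * (d / \<gamma> \<tau>) + q * (d / (\<gamma> \<tau> - z))) (at \<tau>)"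
    by (intro has_vector_derivative_add has_vector_derivative_mult_right dL dM dI)
  from field_vector_diff_chain_at[OF this DERIV_exp]
  have "((\<lambda>s. exp (?E s)) has_vector_derivative
           (d * (1 / (\<gamma> \<tau>)\<^sup>2) + p * (d / \<gamma> \<tau>) + q * (d / (\<gamma> \<tau> - z))) * exp (?E \<tau>)) (at \<tau>)"
    by (simp add: o_def)
  moreover have "(\<lambda>s. exp (?E s)) = branch_integrand \<gamma> L M p q z"
    by (simp add: branch_integrand_def fun_eq_iff flip: exp_add)
  moreover have "branch_integrand \<gamma> L M (p - 1) q z \<tau> = branch_integrand \<gamma> L M p q z \<tau> / \<gamma> \<tau>"
    using branch_integrand_raise(1)[OF L M \<tau> z, of "p - 1" q] nz by simp
  moreover have "branch_integrand \<gamma> L M (p - 2) q z \<tau> =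
      branch_integrand \<gamma> L M p q z \<tau> / (\<gamma> \<tau>)\<^sup>2"
    using branch_integrand_raise(1)[OF L M \<tau> z, of "p - 1" q]
      branch_integrand_raise(1)[OF L M \<tau> z, of "p - 2" q] nz
    by (simp add: power2_eq_square)
  moreover have "branch_integrand \<gamma> L M p (q - 1) z \<tau> =
      branch_integrand \<gamma> L M p q z \<tau> / (\<gamma> \<tau> - z)"
    using branch_integrand_raise(2)[OF L M \<tau> z, of p "q - 1"] nz by simp
  moreover have "exp (?E \<tau>) = branch_integrand \<gamma> L M p q z \<tau>"
    by (simp add: branch_integrand_def flip: exp_add)
  ultimately show ?thesis
    by (simp add: algebra_simps)
qed

lemma continuous_on_branch_integrand:
  assumes "contour \<gamma>" "log_branch \<gamma> L" "log_branch_family U \<gamma> M" "z \<in> U"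
  shows "continuous_on {0<..<1} (branch_integrand \<gamma> L M p q z)"
proof -
  have "continuous_on {0<..<1} \<gamma>" "continuous_on {0<..<1} L" "continuous_on {0<..<1} (M z)"
    using assms
    by (auto simp: contour_def piecewise_C1_differentiable_on_def log_branch_def
        log_branch_family_def)
  moreover have "\<forall>\<tau>\<in>{0<..<1}. \<gamma> \<tau> \<noteq> 0"
    using assms(2) unfolding log_branch_def by (metis exp_not_eq_zero)
  ultimately show ?thesis
    unfolding branch_integrand_def by (auto intro!: continuous_intros)
qed

section \<open>The operator and the integral\<close>

text \<open>
  The values of \<open>h\<close> at 0 and 1 are unrelated to its limits there, so they are replaced by
  these limits to obtain a continuous function on the closed interval.
\<close>

lemma fundamental_theorem_of_calculus_boundary_value:
  fixes h :: "real \<Rightarrow> complex"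
  assumes "finite S" "continuous_on {0<..<1} h" "has_boundary_value h d"
    and deriv: "\<And>x. x \<in> {0<..<1} - S \<Longrightarrow> (h has_vector_derivative h' x) (at x)"
  shows "(h' has_integral d) {0<..<1}"
proof -
  obtain h0 h1 where lim: "(h \<longlongrightarrow> h0) (at_right 0)" "(h \<longlongrightarrow> h1) (at_left 1)" and d: "d = h1 - h0"
    using assms(3) by (auto simp: has_boundary_value_def)
  define g where "g x = (if x \<le> 0 then h0 else if 1 \<le> x then h1 else h x)" for x
  have g: "g x = h x" if "x \<in> {0<..<1}" for x
    using that by (simp add: g_def)
  have "(h' has_integral g 1 - g 0) {0..1}"
  proof (rule fundamental_theorem_of_calculus_interior_strong[OF \<open>finite S\<close>])
    show "continuous_on {0..1} g"
    proof (rule continuous_on_IccI)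
      have "\<forall>\<^sub>F x in at_right 0. g x = h x"
        using eventually_at_right_real[of 0 1] g by (auto elim: eventually_mono)
      then show "(g \<longlongrightarrow> g 0) (at_right 0)"
        using lim(1) by (simp add: g_def[of 0] tendsto_cong)
      have "\<forall>\<^sub>F x in at_left 1. g x = h x"
        using eventually_at_left_real[of 0 1] g by (auto elim: eventually_mono)
      then show "(g \<longlongrightarrow> g 1) (at_left 1)"
        using lim(2) by (simp add: g_def[of 1] tendsto_cong)
      show "g \<midarrow>x\<rightarrow> g x" if "0 < x" "x < 1" for x
      proof -
        have "continuous_on {0<..<1} g"
          by (rule continuous_on_eq[OF assms(2)]) (simp add: g)
        with that show ?thesis
          by (simp add: continuous_on_eq_continuous_at isCont_def)
      qed
    qed simp
    show "(g has_vector_derivative h' x) (at x)" if "x \<in> {0<..<1} - S" for x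
      by (rule has_vector_derivative_transform_within_open[OF deriv[OF that], of "{0<..<1}"])
        (use that g in auto)
  qed simp
  then show ?thesis
    by (simp add: g_def d has_integral_Icc_iff_Ioo)
qed

text \<open>
  This exactness is what reduces the differential equation to the boundary condition.
  To verify it, all occurring integrands are written
  as polynomials in \<open>t\<close> and \<open>z\<close> times the one with the lowest exponents,
  \<open>f = e\<^sup>-\<^sup>1\<^sup>/\<^sup>t t\<^sup>b\<^sup>-\<^sup>a\<^sup>-\<^sup>1 (t - z)\<^sup>-\<^sup>b\<^sup>-\<^sup>2\<close>.
\<close>

lemma hyp2F0_integrand_exact:
  assumes "open U" and L: "log_branch \<gamma> L" and M: "log_branch_family U \<gamma> M"
    and \<tau>: "\<tau> \<in> {0<..<1}" and z: "z \<in> U"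
    and \<gamma>: "(\<gamma> has_vector_derivative d) (at \<tau>)"
  shows "((\<lambda>s. - b * branch_integrand \<gamma> L M (b - a + 1) (- b - 1) z s) has_vector_derivative
           hyp2F0_op a b (\<lambda>w. branch_integrand \<gamma> L M (b - a - 1) (- b) w \<tau>) z * d) (at \<tau>)"
proof -
  define f where "f = branch_integrand \<gamma> L M (b - a - 1) (- b - 2) z \<tau>"
  define t where "t = \<gamma> \<tau>"
  note raise = branch_integrand_raise[OF L M \<tau> z]
  have f1: "branch_integrand \<gamma> L M (b - a - 1) (- b - 1) z \<tau> = (t - z) * f"
    using raise(2)[of "b - a - 1" "- b - 2"] by (simp add: f_def t_def minus_diff_commute)
  have f0: "branch_integrand \<gamma> L M (b - a - 1) (- b) z \<tau> = (t - z)\<^sup>2 * f"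
    using raise(2)[of "b - a - 1" "- b - 1"] f1 by (simp add: t_def power2_eq_square)
  have g1: "branch_integrand \<gamma> L M (b - a) (- b - 1) z \<tau> = t * (t - z) * f"
    using raise(1)[of "b - a - 1" "- b - 1"] f1 by (simp add: t_def)
  have g2: "branch_integrand \<gamma> L M (b - a + 1) (- b - 2) z \<tau> = t\<^sup>2 * f"
    using raise(1)[of "b - a - 1" "- b - 2"] raise(1)[of "b - a" "- b - 2"]
    by (simp add: f_def t_def power2_eq_square)
  have "deriv (\<lambda>w. branch_integrand \<gamma> L M (b - a - 1) (- b) w \<tau>) z = b * ((t - z) * f)"
    using higher_deriv_branch_integrand[OF \<open>open U\<close> L M \<tau> z, of 1 "b - a - 1" "- b"]
    by (simp add: f1)
  moreover have "pochhammer b 2 = b * (b + 1)"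
    by (simp add: numeral_2_eq_2 pochhammer_Suc)
  then have "(deriv ^^ 2) (\<lambda>w. branch_integrand \<gamma> L M (b - a - 1) (- b) w \<tau>) z = b * (b + 1) * f"
    using higher_deriv_branch_integrand[OF \<open>open U\<close> L M \<tau> z, of 2 "b - a - 1" "- b"]
    by (simp add: f_def)
  ultimately have "hyp2F0_op a b (\<lambda>w. branch_integrand \<gamma> L M (b - a - 1) (- b) w \<tau>) z =
      (z\<^sup>2 * (b * (b + 1)) + (- 1 + (1 + a + b) * z) * (b * (t - z)) + a * b * (t - z)\<^sup>2) * f"
    by (simp only: hyp2F0_op_def f0) (simp add: algebra_simps)
  also have "\<dots> = - b * ((t - z) * f + (b - a + 1) * (t * (t - z) * f) + (- b - 1) * (t\<^sup>2 * f))"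
    by (simp add: algebra_simps power2_eq_square)
  finally have operator: "hyp2F0_op a b (\<lambda>w. branch_integrand \<gamma> L M (b - a - 1) (- b) w \<tau>) z = \<dots>" .
  have exponents: "b - a + 1 - 2 = b - a - 1" "b - a + 1 - 1 = b - a" "- b - 1 - 1 = - b - 2"
    by simp_all
  have "(branch_integrand \<gamma> L M (b - a + 1) (- b - 1) z has_vector_derivative
      ((t - z) * f + (b - a + 1) * (t * (t - z) * f) + (- b - 1) * (t\<^sup>2 * f)) * d) (at \<tau>)"
    using has_vector_derivative_branch_integrand[OF L M \<tau> z \<gamma>, of "b - a + 1" "- b - 1"]
    by (simp only: exponents f1 g1 g2)
  from has_vector_derivative_mult_right[OF this, of "- b"] show ?thesis
    by (simp only: operator mult.assoc)
qed

lemma hyp2F0_op_integral_along: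
  assumes "open U" "twice_differentiable_under_integral U \<gamma> f" "z \<in> U"
  shows "((\<lambda>\<tau>. hyp2F0_op a b (\<lambda>w. f w \<tau>) z * vector_derivative \<gamma> (at \<tau>)) has_integral
           hyp2F0_op a b (\<lambda>w. integral_along \<gamma> (f w)) z) {0<..<1}"
proof -
  define I where "I k w = integral_along \<gamma> (\<lambda>\<tau>. (deriv ^^ k) (\<lambda>v. f v \<tau>) w)" for k w
  have I: "((\<lambda>\<tau>. (deriv ^^ k) (\<lambda>v. f v \<tau>) z * vector_derivative \<gamma> (at \<tau>)) has_integral I k z) {0<..<1}"
    if "k \<le> 2" for k
    using assms(2,3) that
    unfolding twice_differentiable_under_integral_def integrable_along_def integral_along_def I_def
    by (blast intro: integrable_integral)
  have dI: "(I k has_field_derivative I (Suc k) w) (at w)" if "k < 2" "w \<in> U" for k w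
    using assms(2) that unfolding twice_differentiable_under_integral_def I_def by blast
  have d1: "deriv (I 0) w = I 1 w" if "w \<in> U" for w
    using dI[of 0 w] that by (simp add: DERIV_imp_deriv)
  \<comment> \<open>The iterated derivative needs the first one on a neighbourhood of \<open>z\<close>; openness of
    \<open>U\<close> provides it.\<close>
  have "(deriv (I 0) has_field_derivative I 2 z) (at z)"
    by (rule has_field_derivative_transform_within_open[of "I 1" _ _ U])
      (use dI[of 1 z] assms d1 in \<open>auto simp: numeral_2_eq_2\<close>)
  then have d2: "(deriv ^^ 2) (I 0) z = I 2 z"
    by (simp add: DERIV_imp_deriv numeral_2_eq_2)
  have "((\<lambda>\<tau>. z\<^sup>2 * ((deriv ^^ 2) (\<lambda>v. f v \<tau>) z * vector_derivative \<gamma> (at \<tau>))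
        + (- 1 + (1 + a + b) * z) * ((deriv ^^ 1) (\<lambda>v. f v \<tau>) z * vector_derivative \<gamma> (at \<tau>))
        + a * b * ((deriv ^^ 0) (\<lambda>v. f v \<tau>) z * vector_derivative \<gamma> (at \<tau>)))
      has_integral z\<^sup>2 * I 2 z + (- 1 + (1 + a + b) * z) * I 1 z + a * b * I 0 z) {0<..<1}"
    by (intro has_integral_add has_integral_mult_right I) simp_all
  moreover have "hyp2F0_op a b (I 0) z =
      z\<^sup>2 * I 2 z + (- 1 + (1 + a + b) * z) * I 1 z + a * b * I 0 z"
    using d1[OF \<open>z \<in> U\<close>] d2 by (simp add: hyp2F0_op_def)
  moreover have "I 0 = (\<lambda>w. integral_along \<gamma> (f w))"
    by (simp add: I_def fun_eq_iff)
  moreover have "hyp2F0_op a b (\<lambda>w. f w \<tau>) z * vector_derivative \<gamma> (at \<tau>) =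
      z\<^sup>2 * ((deriv ^^ 2) (\<lambda>v. f v \<tau>) z * vector_derivative \<gamma> (at \<tau>))
        + (- 1 + (1 + a + b) * z) * ((deriv ^^ 1) (\<lambda>v. f v \<tau>) z * vector_derivative \<gamma> (at \<tau>))
        + a * b * ((deriv ^^ 0) (\<lambda>v. f v \<tau>) z * vector_derivative \<gamma> (at \<tau>))" for \<tau>
    by (simp add: hyp2F0_op_def distrib_right mult.assoc)
  ultimately show ?thesis
    by simp
qed

theorem theorem4p2:
  fixes a b :: complex and U :: "complex set" and \<gamma> :: "real \<Rightarrow> complex"
    and L :: "real \<Rightarrow> complex" and M :: "complex \<Rightarrow> real \<Rightarrow> complex"
  assumes "open U"
    and "contour \<gamma>"
    and "\<forall>\<tau>\<in>{0<..<1}. \<gamma> \<tau> \<noteq> 0 \<and> \<gamma> \<tau> \<notin> U"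
    and "log_branch \<gamma> L"
    and "log_branch_family U \<gamma> M"
    and "\<forall>z\<in>U. integrable_along \<gamma> (branch_integrand \<gamma> L M (b - a - 1) (- b) z)"
    and "twice_differentiable_under_integral U \<gamma> (branch_integrand \<gamma> L M (b - a - 1) (- b))"
    and "\<forall>z\<in>U. has_boundary_value (branch_integrand \<gamma> L M (b - a + 1) (- b - 1) z) 0"
  shows "\<forall>z\<in>U. hyp2F0_op a b
           (\<lambda>w. integral_along \<gamma> (branch_integrand \<gamma> L M (b - a - 1) (- b) w)) z = 0"
proof
  fix z assume z: "z \<in> U"
  let ?f = "branch_integrand \<gamma> L M (b - a - 1) (- b)"
  let ?G = "\<lambda>s. - b * branch_integrand \<gamma> L M (b - a + 1) (- b - 1) z s"
  obtain S where "finite S" and S: "\<gamma> C1_differentiable_on {0<..<1} - S"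
    using assms(2) by (auto simp: contour_def piecewise_C1_differentiable_on_def)
  have "((\<lambda>\<tau>. hyp2F0_op a b (\<lambda>w. ?f w \<tau>) z * vector_derivative \<gamma> (at \<tau>)) has_integral 0) {0<..<1}"
  proof (rule fundamental_theorem_of_calculus_boundary_value[OF \<open>finite S\<close>, of ?G])
    show "continuous_on {0<..<1} ?G"
      by (intro continuous_intros continuous_on_branch_integrand[OF assms(2,4,5) z])
    show "has_boundary_value ?G 0"
      using assms(8) z unfolding has_boundary_value_def by (fastforce intro: tendsto_mult_left)
    show "(?G has_vector_derivative hyp2F0_op a b (\<lambda>w. ?f w \<tau>) z * vector_derivative \<gamma> (at \<tau>)) (at \<tau>)"
      if "\<tau> \<in> {0<..<1} - S" for \<tau>
    proof (rule hyp2F0_integrand_exact[OF assms(1,4,5) _ z])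
      show "(\<gamma> has_vector_derivative vector_derivative \<gamma> (at \<tau>)) (at \<tau>)"
        using S that by (simp add: C1_differentiable_on_eq vector_derivative_works)
    qed (use that in simp)
  qed
  with hyp2F0_op_integral_along[OF assms(1,7) z]
  show "hyp2F0_op a b (\<lambda>w. integral_along \<gamma> (?f w)) z = 0"
    by (rule has_integral_unique)
qed

end
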